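(* There exists an outer-1-planar graph $G$ whose $3$-dynamic chromatic number is $6$, i.e. $\chi_3(G)=6$.
   Context: Graphs are finite and simple. A graph is outer-1-planar if it has a drawing in the plane so that all vertices appear in the outer region of the drawing and every edge crosses at most one other edge. A proper $k$-coloring of a graph $G$ is a function $c:V(G)\to\{1,\dots,k\}$ such that $c(u)\ne c(v)$ whenever $u$ is adjacent to $v$. For $r\ge 1$, an $r$-dynamic $k$-coloring of $G$ is a proper $k$-coloring such that, for every vertex $v$, at least $\min\{r,d(v)\}$ distinct colors appear on the neighbors of $v$, where $d(v)$ denotes the degree of $v$. The $r$-dynamic chromatic number $\chi_r(G)$ is the minimum integer $k$ such that $G$ has an $r$-dynamic $k$-coloring. *)

theory Defs
  imports "HOL-Analysis.Analysis" "Graph_Theory.Graph_Theory"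
begin

text \<open>
  A finite simple graph is a \<open>pair_graph\<close>: a finite, loop-free, symmetric digraph without
  parallel arcs. Its undirected edges are the two-element sets below.
\<close>

definition undirected_edges :: "'a pair_pre_digraph \<Rightarrow> 'a set set" where
  "undirected_edges G = (\<lambda>(u, v). {u, v}) ` parcs G"

text \<open>
  The usual conventions on drawings are imposed: vertices are distinct points, edges are simple
  arcs joining their endpoints and avoiding all other vertices, and two different edges have at
  most one point in common (a shared endpoint or a crossing). In particular two edges cross at
  most once and adjacent edges do not cross.
\<close>

definition plane_drawing ::
  "'a pair_pre_digraph \<Rightarrow> ('a \<Rightarrow> complex) \<Rightarrow> ('a set \<Rightarrow> real \<Rightarrow> complex) \<Rightarrow> bool" where
  "plane_drawing G pos \<gamma> \<longleftrightarrow>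
     inj_on pos (pverts G) \<and>
     (\<forall>e \<in> undirected_edges G.
        arc (\<gamma> e) \<and>
        {pathstart (\<gamma> e), pathfinish (\<gamma> e)} = pos ` e \<and>
        path_image (\<gamma> e) \<inter> pos ` pverts G = pos ` e) \<and>
     (\<forall>e \<in> undirected_edges G. \<forall>f \<in> undirected_edges G. e \<noteq> f \<longrightarrow>
        (\<forall>x \<in> path_image (\<gamma> e) \<inter> path_image (\<gamma> f).
         \<forall>y \<in> path_image (\<gamma> e) \<inter> path_image (\<gamma> f). x = y))"

text \<open>
  Any common point other than a vertex counts as a crossing, so edges touching without
  crossing transversally are treated as crossing each other.
\<close>

definition edges_cross ::
  "'a pair_pre_digraph \<Rightarrow> ('a \<Rightarrow> complex) \<Rightarrow> ('a set \<Rightarrow> real \<Rightarrow> complex) \<Rightarrow> 'a set \<Rightarrow> 'a set \<Rightarrow> bool" where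
  "edges_cross G pos \<gamma> e f \<longleftrightarrow>
     e \<noteq> f \<and> path_image (\<gamma> e) \<inter> path_image (\<gamma> f) - pos ` pverts G \<noteq> {}"

definition drawing_points ::
  "'a pair_pre_digraph \<Rightarrow> ('a \<Rightarrow> complex) \<Rightarrow> ('a set \<Rightarrow> real \<Rightarrow> complex) \<Rightarrow> complex set" where
  "drawing_points G pos \<gamma> = pos ` pverts G \<union> (\<Union>e \<in> undirected_edges G. path_image (\<gamma> e))"

text \<open>
  The outer region is the unbounded component of the complement of the drawing; a vertex
  appears in it if it lies on its boundary.
\<close>

definition outer_1_planar :: "'a pair_pre_digraph \<Rightarrow> bool" where
  "outer_1_planar G \<longleftrightarrow>
     (\<exists>pos \<gamma>. plane_drawing G pos \<gamma> \<and>
        (\<forall>v \<in> pverts G. pos v \<in> frontier (outside (drawing_points G pos \<gamma>))) \<and>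
        (\<forall>e \<in> undirected_edges G. \<forall>f \<in> undirected_edges G. \<forall>g \<in> undirected_edges G.
           edges_cross G pos \<gamma> e f \<and> edges_cross G pos \<gamma> e g \<longrightarrow> f = g))"

definition proper_coloring :: "'a pair_pre_digraph \<Rightarrow> nat \<Rightarrow> ('a \<Rightarrow> nat) \<Rightarrow> bool" where
  "proper_coloring G k c \<longleftrightarrow>
     c ` pverts G \<subseteq> {1..k} \<and> (\<forall>(u, v) \<in> parcs G. c u \<noteq> c v)"

text \<open>In a \<open>pair_graph\<close> the out-degree of a vertex is its degree as an undirected graph.\<close>

definition dynamic_coloring ::
  "nat \<Rightarrow> 'a pair_pre_digraph \<Rightarrow> nat \<Rightarrow> ('a \<Rightarrow> nat) \<Rightarrow> bool" where
  "dynamic_coloring r G k c \<longleftrightarrow>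
     proper_coloring G k c \<and>
     (\<forall>v \<in> pverts G. card (c ` {w. (v, w) \<in> parcs G}) \<ge> min r (out_degree (with_proj G) v))"

definition dynamic_chromatic_number :: "nat \<Rightarrow> 'a pair_pre_digraph \<Rightarrow> nat" where
  "dynamic_chromatic_number r G = (LEAST k. \<exists>c. dynamic_coloring r G k c)"

end

theory Submission
  imports Defs
begin

text \<open>
  The witness is the graph formed by two vertices, 2 and 4, joined by three internally disjoint
  paths of lengths 2, 2 and 3: the path \<open>0, 1, 2, 3, 4, 5\<close> together with the chords
  \<open>{0, 4}\<close> and \<open>{2, 5}\<close>.

  Its maximum degree is 3, so a 3-dynamic coloring must give distinct colors to all neighbors of
  each vertex; being proper, it therefore separates any two vertices at distance at most 2. The
  diameter of the graph is 2, hence every 3-dynamic coloring is injective and uses at least 6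
  colors, while an injective coloring is trivially dynamic
  (\<open>dynamic_chromatic_number_diameter_two\<close>).

  For the drawing, the vertices are put in convex position, the vertex \<open>i\<close> at
  \<open>(i, i\<^sup>2)\<close> on a parabola, with straight edges. Everything then lies in the convex
  region above the parabola, so all vertices are on the outer boundary, and two edges can cross
  only if their endpoints interleave along the parabola (\<open>outer_1_planar_if_interlaced\<close>).
  Of the seven edges only \<open>{0, 4}\<close> and \<open>{2, 5}\<close> interleave, so each edge is crossed at most once.
\<close>

section \<open>Dynamic colorings of graphs of diameter two\<close>

lemma (in pair_graph) out_degree_eq_card_neighbors:
  "out_degree (with_proj G) v = card {w. (v, w) \<in> parcs G}"
proof -
  have "out_arcs (with_proj G) v = Pair v ` {w. (v, w) \<in> parcs G}"
    by (auto simp: out_arcs_def)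
  then show ?thesis
    by (simp add: out_degree_def card_image inj_on_def)
qed

lemma (in pair_graph) finite_neighbors: "finite {w. (v, w) \<in> parcs G}"
  by (rule finite_subset[OF _ finite_verts]) (auto dest: in_arcsD2)

text \<open>
  When no degree exceeds \<open>r\<close>, the minimum of \<open>r\<close> and the degree is the degree, so
  the neighborhood of each vertex is rainbow and the coloring separates vertices at distance one
  or two.
\<close>

lemma (in pair_graph) dynamic_coloring_inj_on:
  assumes col: "dynamic_coloring r G k c"
    and deg: "\<And>v. v \<in> pverts G \<Longrightarrow> card {w. (v, w) \<in> parcs G} \<le> r"
    and diam: "\<And>u v. u \<in> pverts G \<Longrightarrow> v \<in> pverts G \<Longrightarrow> u \<noteq> v \<Longrightarrow>
      (u, v) \<in> parcs G \<or> (\<exists>w. (w, u) \<in> parcs G \<and> (w, v) \<in> parcs G)"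
  shows "inj_on c (pverts G)"
proof (rule inj_onI, rule ccontr)
  fix u v assume uv: "u \<in> pverts G" "v \<in> pverts G" "c u = c v" "u \<noteq> v"
  from diam[OF uv(1,2,4)] show False
  proof
    assume "(u, v) \<in> parcs G"
    with col uv(3) show False
      by (auto simp: dynamic_coloring_def proper_coloring_def)
  next
    assume "\<exists>w. (w, u) \<in> parcs G \<and> (w, v) \<in> parcs G"
    then obtain w where w: "(w, u) \<in> parcs G" "(w, v) \<in> parcs G" by blast
    let ?N = "{x. (w, x) \<in> parcs G}"
    have "w \<in> pverts G" using w(1) by (auto dest: in_arcsD1)
    then have "card ?N \<le> card (c ` ?N)"
      using col deg[of w] by (auto simp: dynamic_coloring_def out_degree_eq_card_neighbors)
    then have "inj_on c ?N"
      using finite_neighbors[of w] by (intro eq_card_imp_inj_on) (auto intro: antisym card_image_le)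
    with w uv(3,4) show False by (auto dest: inj_onD)
  qed
qed

lemma (in pair_graph) dynamic_coloring_if_inj_on:
  assumes inj: "inj_on c (pverts G)" and range: "c ` pverts G \<subseteq> {1..k}"
  shows "dynamic_coloring r G k c"
proof -
  have "inj_on c {w. (v, w) \<in> parcs G}" for v
    by (rule inj_on_subset[OF inj]) (auto dest: in_arcsD2)
  moreover have "c u \<noteq> c v" if "(u, v) \<in> parcs G" for u v
    using no_loops[OF that] inj_onD[OF inj _ in_arcsD1[OF that] in_arcsD2[OF that]] by auto
  ultimately show ?thesis
    using range
    by (auto simp: dynamic_coloring_def proper_coloring_def out_degree_eq_card_neighbors card_image)
qed

lemma (in pair_graph) dynamic_chromatic_number_diameter_two:
  assumes deg: "\<And>v. v \<in> pverts G \<Longrightarrow> card {w. (v, w) \<in> parcs G} \<le> r"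
    and diam: "\<And>u v. u \<in> pverts G \<Longrightarrow> v \<in> pverts G \<Longrightarrow> u \<noteq> v \<Longrightarrow>
      (u, v) \<in> parcs G \<or> (\<exists>w. (w, u) \<in> parcs G \<and> (w, v) \<in> parcs G)"
  shows "dynamic_chromatic_number r G = card (pverts G)"
  unfolding dynamic_chromatic_number_def
proof (rule Least_equality)
  obtain h where h: "bij_betw h (pverts G) {0..<card (pverts G)}"
    using ex_bij_betw_finite_nat[OF finite_verts] by auto
  have "inj_on (Suc \<circ> h) (pverts G)"
    using h by (auto simp: bij_betw_def inj_on_def)
  moreover have "(Suc \<circ> h) ` pverts G \<subseteq> {1..card (pverts G)}"
    using bij_betwE[OF h] by (auto simp: Suc_le_eq)
  ultimately have "dynamic_coloring r G (card (pverts G)) (Suc \<circ> h)"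
    by (rule dynamic_coloring_if_inj_on)
  then show "\<exists>c. dynamic_coloring r G (card (pverts G)) c" by blast
next
  fix k assume "\<exists>c. dynamic_coloring r G k c"
  then obtain c where c: "dynamic_coloring r G k c" by blast
  then have "c ` pverts G \<subseteq> {1..k}"
    by (simp add: dynamic_coloring_def proper_coloring_def)
  then have "card (c ` pverts G) \<le> k"
    using card_mono[of "{1..k}" "c ` pverts G"] by simp
  then show "card (pverts G) \<le> k"
    using dynamic_coloring_inj_on[OF c deg diam] by (simp add: card_image)
qed

section \<open>Straight-line drawings on a parabola\<close>

definition parabola_point :: "nat \<Rightarrow> complex" where
  "parabola_point i = Complex (real i) (real i ^ 2)"

definition chord :: "nat set \<Rightarrow> real \<Rightarrow> complex" where
  "chord e = linepath (parabola_point (Min e)) (parabola_point (Max e))"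

definition interlaced :: "nat set \<Rightarrow> nat set \<Rightarrow> bool" where
  "interlaced e f \<longleftrightarrow>
     Min e < Min f \<and> Min f < Max e \<and> Max e < Max f \<or>
     Min f < Min e \<and> Min e < Max f \<and> Max f < Max e"

lemma inj_parabola_point: "inj parabola_point"
  by (auto simp: inj_on_def parabola_point_def)

lemma Re_parabola_point [simp]: "Re (parabola_point i) = real i"
  and Im_parabola_point [simp]: "Im (parabola_point i) = real i ^ 2"
  by (simp_all add: parabola_point_def)

text \<open>
  A point of a chord is measured by its height above the parabola, which at abscissa \<open>x\<close> is
  \<open>(x - a) (b - x)\<close>. All questions about common points of chords become questions about
  these quadratics.
\<close>

lemma chord_height:
  assumes "z \<in> path_image (chord {a, b})" "a < b"
  shows "real a \<le> Re z" "Re z \<le> real b"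
    and "Im z = (Re z)\<^sup>2 + (Re z - real a) * (real b - Re z)"
proof -
  have mm: "Min {a, b} = a" "Max {a, b} = b" using \<open>a < b\<close> by auto
  from assms(1) obtain t where t: "0 \<le> t" "t \<le> 1"
    "z = (1 - t) *\<^sub>R parabola_point a + t *\<^sub>R parabola_point b"
    unfolding chord_def mm path_image_linepath in_segment by blast
  have re: "Re z = real a + t * (real b - real a)"
    unfolding t(3) by (simp add: algebra_simps)
  have im: "Im z = (1 - t) * (real a)\<^sup>2 + t * (real b)\<^sup>2"
    unfolding t(3) by simp
  show "real a \<le> Re z" using re t(1) \<open>a < b\<close> by simp
  have "t * (real b - real a) \<le> 1 * (real b - real a)"
    using t(2) \<open>a < b\<close> by (intro mult_right_mono) auto
  then show "Re z \<le> real b" using re by simp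
  show "Im z = (Re z)\<^sup>2 + (Re z - real a) * (real b - Re z)"
    unfolding re im by (simp add: algebra_simps power2_eq_square)
qed

lemma endpoints_in_chord:
  assumes "a < b"
  shows "parabola_point a \<in> path_image (chord {a, b})"
    and "parabola_point b \<in> path_image (chord {a, b})"
  using assms by (auto simp: chord_def)

lemma chord_meets_parabola:
  assumes "parabola_point i \<in> path_image (chord {a, b})" "a < b"
  shows "i = a \<or> i = b"
  using chord_height(3)[OF assms] by auto

text \<open>
  The height functions of two chords differ by a linear function. If it vanishes at two abscissas,
  it is zero, so the quadratics have the same sum and product of roots, hence the same roots.
\<close>

lemma distinct_chords_meet_once:
  assumes x: "x \<in> path_image (chord {a, b}) \<inter> path_image (chord {c, d})"
    and y: "y \<in> path_image (chord {a, b}) \<inter> path_image (chord {c, d})"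
    and less: "a < b" "c < d" and ne: "{a, b} \<noteq> {c, d}"
  shows "x = y"
proof (rule ccontr)
  assume "x \<noteq> y"
  let ?A = "real a" and ?B = "real b" and ?C = "real c" and ?D = "real d"
  have hx: "Im x = (Re x)\<^sup>2 + (Re x - ?A) * (?B - Re x)"
    "Im x = (Re x)\<^sup>2 + (Re x - ?C) * (?D - Re x)"
    and hy: "Im y = (Re y)\<^sup>2 + (Re y - ?A) * (?B - Re y)"
    "Im y = (Re y)\<^sup>2 + (Re y - ?C) * (?D - Re y)"
    using x y less by (auto dest: chord_height(3))
  have re: "Re x \<noteq> Re y" using hx(1) hy(1) \<open>x \<noteq> y\<close> by (auto simp: complex_eq_iff)
  have lx: "(?A + ?B - ?C - ?D) * Re x = ?A * ?B - ?C * ?D"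
    and ly: "(?A + ?B - ?C - ?D) * Re y = ?A * ?B - ?C * ?D"
    using hx hy by (simp_all add: algebra_simps power2_eq_square)
  then have "(?A + ?B - ?C - ?D) * (Re x - Re y) = 0" by (simp add: algebra_simps)
  with re have sums: "?A + ?B = ?C + ?D" by simp
  with lx have "?A * ?B = ?C * ?D" by simp
  then have "(?A - ?C) * (?A - ?D) = 0"
    using sums by (simp add: algebra_simps) (metis distrib_left)
  with sums less ne show False by auto
qed

text \<open>
  At a common point the heights \<open>(x - a) (b - x)\<close> and \<open>(x - c) (d - x)\<close> agree and
  are positive; if one interval contained the other, the larger interval would give the larger
  height.
\<close>

lemma crossing_chords_interleave:
  assumes z: "z \<in> path_image (chord {a, b})" "z \<in> path_image (chord {c, d})"
    and less: "a < b" "c < d" and ne: "{a, b} \<noteq> {c, d}" and le: "a \<le> c"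
    and inner: "z \<notin> parabola_point ` {a, b, c, d}"
  shows "a < c \<and> c < b \<and> b < d"
proof -
  let ?x = "Re z"
  note h = chord_height[OF z(1) less(1)] and h' = chord_height[OF z(2) less(2)]
  have off: "?x \<noteq> real i" if "i \<in> {a, b, c, d}" for i
  proof
    assume "?x = real i"
    moreover have "Im z = ?x\<^sup>2"
      using that \<open>?x = real i\<close> h(3) h'(3) by auto
    ultimately have "z = parabola_point i" by (simp add: complex_eq_iff)
    with inner that show False by blast
  qed
  have pos: "0 < ?x - real a" "0 < real b - ?x" "0 < ?x - real c" "0 < real d - ?x"
    using h(1,2) h'(1,2) off[of a] off[of b] off[of c] off[of d] by auto
  have eq: "(?x - real a) * (real b - ?x) = (?x - real c) * (real d - ?x)"
    using h(3) h'(3) by simp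
  have "a \<noteq> c"
    using eq pos ne by auto
  then have ac: "a < c" using le by simp
  have "b < d"
  proof (rule ccontr)
    assume "\<not> b < d"
    then have "(?x - real c) * (real d - ?x) < (?x - real a) * (real b - ?x)"
      using ac pos by (intro mult_less_le_imp_less) auto
    with eq show False by simp
  qed
  moreover have "c < b" using pos by linarith
  ultimately show ?thesis using ac by blast
qed

lemma crossing_chords_interlaced:
  assumes z: "z \<in> path_image (chord {a, b})" "z \<in> path_image (chord {c, d})"
    and less: "a < b" "c < d" and ne: "{a, b} \<noteq> {c, d}"
    and inner: "z \<notin> parabola_point ` {a, b, c, d}"
  shows "interlaced {a, b} {c, d}"
proof (cases "a \<le> c")
  case True
  with crossing_chords_interleave[OF z less ne] inner less show ?thesis
    by (auto simp: interlaced_def)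
next
  case False
  moreover have "z \<notin> parabola_point ` {c, d, a, b}" using inner by auto
  ultimately show ?thesis
    using crossing_chords_interleave[OF z(2,1) less(2,1)] ne less
    by (auto simp: interlaced_def)
qed

lemma convex_above_parabola: "convex {z. (Re z)\<^sup>2 \<le> Im z}"
proof (rule convexI)
  fix x y :: complex and u v :: real
  assume xy: "x \<in> {z. (Re z)\<^sup>2 \<le> Im z}" "y \<in> {z. (Re z)\<^sup>2 \<le> Im z}"
    and uv: "0 \<le> u" "0 \<le> v" "u + v = 1"
  have v: "v = 1 - u" using uv(3) by simp
  have "(u * Re x + v * Re y)\<^sup>2 = u * (Re x)\<^sup>2 + v * (Re y)\<^sup>2 - u * v * (Re x - Re y)\<^sup>2"
    unfolding v by (simp add: algebra_simps power2_eq_square)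
  also have "\<dots> \<le> u * (Re x)\<^sup>2 + v * (Re y)\<^sup>2" using uv by simp
  also have "\<dots> \<le> u * Im x + v * Im y"
    using xy uv by (intro add_mono mult_left_mono) auto
  finally show "u *\<^sub>R x + v *\<^sub>R y \<in> {z. (Re z)\<^sup>2 \<le> Im z}" by simp
qed

text \<open>
  A set above the parabola leaves everything below it in the outer region, and a point of the
  parabola is a limit of points vertically below it.
\<close>

lemma parabola_point_in_frontier_outside:
  assumes S: "S \<subseteq> {z. (Re z)\<^sup>2 \<le> Im z}" and i: "parabola_point i \<in> S"
  shows "parabola_point i \<in> frontier (outside S)"
proof -
  have below: "- {z. (Re z)\<^sup>2 \<le> Im z} \<subseteq> outside S"
    by (rule outside_subset_convex[OF convex_above_parabola S])
  have "parabola_point i \<in> closure (outside S)"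
    unfolding closure_approachable
  proof (intro allI impI)
    fix \<epsilon> :: real assume "\<epsilon> > 0"
    let ?y = "Complex (real i) (real i ^ 2 - \<epsilon> / 2)"
    have "?y \<in> outside S" using below \<open>\<epsilon> > 0\<close> by auto
    moreover have "?y - parabola_point i = Complex 0 (- (\<epsilon> / 2))"
      by (simp add: complex_eq_iff)
    then have "dist ?y (parabola_point i) < \<epsilon>"
      using \<open>\<epsilon> > 0\<close> by (simp add: dist_norm complex_norm)
    ultimately show "\<exists>y\<in>outside S. dist y (parabola_point i) < \<epsilon>" by blast
  qed
  moreover have "parabola_point i \<notin> interior (outside S)"
    using i interior_subset outside_no_overlap[of S] by blast
  ultimately show ?thesis by (simp add: frontier_def)
qed

lemma undirected_edge_cases:
  fixes G :: "'a::linorder pair_pre_digraph"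
  assumes "pair_graph G" and e: "e \<in> undirected_edges G"
  obtains a b where "a < b" "e = {a, b}" "a \<in> pverts G" "b \<in> pverts G"
proof -
  interpret pair_graph G by fact
  from e obtain u v where uv: "(u, v) \<in> parcs G" "e = {u, v}"
    by (auto simp: undirected_edges_def)
  have "u \<noteq> v" "u \<in> pverts G" "v \<in> pverts G"
    using no_loops[OF uv(1)] uv(1) by (auto dest: in_arcsD1 in_arcsD2)
  with uv(2) that[of u v] that[of v u] show thesis
    by (cases u v rule: linorder_cases) auto
qed

lemma plane_drawing_parabola:
  assumes G: "pair_graph G"
  shows "plane_drawing G parabola_point chord"
  unfolding plane_drawing_def
proof (intro conjI ballI impI)
  show "inj_on parabola_point (pverts G)"
    by (rule inj_on_subset[OF inj_parabola_point]) simp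
  fix e assume e: "e \<in> undirected_edges G"
  then obtain a b where ab: "a < b" "e = {a, b}" "a \<in> pverts G" "b \<in> pverts G"
    by (rule undirected_edge_cases[OF G])
  have mm: "Min e = a" "Max e = b" using ab by auto
  show "arc (chord e)"
    unfolding chord_def mm
    using ab(1) inj_parabola_point by (intro arc_linepath) (auto dest: injD)
  show "{pathstart (chord e), pathfinish (chord e)} = parabola_point ` e"
    unfolding chord_def mm by (simp add: ab(2))
  show "path_image (chord e) \<inter> parabola_point ` pverts G = parabola_point ` e"
    using chord_meets_parabola[of _ a b] endpoints_in_chord[of a b] ab by auto
  fix f x y
  assume f: "f \<in> undirected_edges G" and "e \<noteq> f"
    and "x \<in> path_image (chord e) \<inter> path_image (chord f)"
    and "y \<in> path_image (chord e) \<inter> path_image (chord f)"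
  moreover from f obtain c d where "c < d" "f = {c, d}"
    by (rule undirected_edge_cases[OF G])
  ultimately show "x = y"
    using distinct_chords_meet_once[of x a b c d y] ab(1,2) by simp
qed

lemma edges_cross_parabola_interlaced:
  assumes G: "pair_graph G" and e: "e \<in> undirected_edges G" and f: "f \<in> undirected_edges G"
    and cross: "edges_cross G parabola_point chord e f"
  shows "interlaced e f"
proof -
  from e obtain a b where ab: "a < b" "e = {a, b}" "a \<in> pverts G" "b \<in> pverts G"
    by (rule undirected_edge_cases[OF G])
  from f obtain c d where cd: "c < d" "f = {c, d}" "c \<in> pverts G" "d \<in> pverts G"
    by (rule undirected_edge_cases[OF G])
  from cross obtain z where z: "z \<in> path_image (chord e)" "z \<in> path_image (chord f)"
    "z \<notin> parabola_point ` pverts G" "e \<noteq> f"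
    by (auto simp: edges_cross_def)
  have "z \<notin> parabola_point ` {a, b, c, d}" using z(3) ab cd by blast
  with z ab cd crossing_chords_interlaced[of z a b c d] show ?thesis by simp
qed

lemma outer_1_planar_if_interlaced:
  assumes G: "pair_graph G"
    and once: "\<And>e f g. e \<in> undirected_edges G \<Longrightarrow> f \<in> undirected_edges G \<Longrightarrow>
      g \<in> undirected_edges G \<Longrightarrow> interlaced e f \<Longrightarrow> interlaced e g \<Longrightarrow> f = g"
  shows "outer_1_planar G"
proof -
  let ?S = "drawing_points G parabola_point chord"
  have "path_image (chord e) \<subseteq> {z. (Re z)\<^sup>2 \<le> Im z}" if e: "e \<in> undirected_edges G" for e
  proof
    fix z assume z: "z \<in> path_image (chord e)"
    from e obtain a b where ab: "a < b" "e = {a, b}" by (rule undirected_edge_cases[OF G])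
    show "z \<in> {z. (Re z)\<^sup>2 \<le> Im z}"
      using chord_height[OF z[unfolded ab(2)] ab(1)] by simp
  qed
  then have "?S \<subseteq> {z. (Re z)\<^sup>2 \<le> Im z}"
    by (auto simp: drawing_points_def)
  then have "parabola_point v \<in> frontier (outside ?S)" if "v \<in> pverts G" for v
    using that by (intro parabola_point_in_frontier_outside) (auto simp: drawing_points_def)
  then show ?thesis
    unfolding outer_1_planar_def
  proof (intro exI[of _ parabola_point] exI[of _ chord] conjI ballI impI)
    fix e f g
    assume "e \<in> undirected_edges G" "f \<in> undirected_edges G" "g \<in> undirected_edges G"
      "edges_cross G parabola_point chord e f \<and> edges_cross G parabola_point chord e g"
    then show "f = g"
      using edges_cross_parabola_interlaced[OF G] by (intro once[of e f g]) simp_all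
  qed (use plane_drawing_parabola[OF G] in simp_all)
qed

section \<open>The graph\<close>

definition theta_edges :: "(nat \<times> nat) set" where
  "theta_edges = {(0, 1), (1, 2), (2, 3), (3, 4), (4, 5), (0, 4), (2, 5)}"

definition theta_graph :: "nat pair_pre_digraph" where
  "theta_graph = \<lparr>pverts = {0, 1, 2, 3, 4, 5}, parcs = theta_edges \<union> theta_edges\<inverse>\<rparr>"

lemma pair_graph_theta: "pair_graph theta_graph"
  by unfold_locales (auto simp: theta_graph_def theta_edges_def symmetric_def intro!: symI)

lemma undirected_edges_theta:
  "undirected_edges theta_graph = {{0, 1}, {1, 2}, {2, 3}, {3, 4}, {4, 5}, {0, 4}, {2, 5}}"
proof -
  have "undirected_edges theta_graph = (\<lambda>(u, v). {u, v}) ` theta_edges"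
    unfolding undirected_edges_def theta_graph_def by (force simp: insert_commute)
  then show ?thesis by (simp only: theta_edges_def image_insert image_empty prod.case)
qed

lemma interlaced_theta:
  assumes "e \<in> undirected_edges theta_graph" "f \<in> undirected_edges theta_graph" "interlaced e f"
  shows "(e, f) \<in> {({0, 4}, {2, 5}), ({2, 5}, {0, 4})}"
  using assms unfolding undirected_edges_theta
  by (elim insertE emptyE; hypsubst; simp add: interlaced_def)

lemma outer_1_planar_theta: "outer_1_planar theta_graph"
proof (rule outer_1_planar_if_interlaced[OF pair_graph_theta])
  fix e f g
  assume "e \<in> undirected_edges theta_graph" "f \<in> undirected_edges theta_graph"
    "g \<in> undirected_edges theta_graph" "interlaced e f" "interlaced e g"
  then have "(e, f) \<in> {({0, 4}, {2, 5}), ({2, 5}, {0, 4})}"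
    and "(e, g) \<in> {({0, 4}, {2, 5}), ({2, 5}, {0, 4})}"
    by (simp_all only: interlaced_theta)
  moreover have "{0, 4} \<noteq> {2, 5 :: nat}" by (simp add: doubleton_eq_iff)
  ultimately show "f = g" by (metis Pair_inject insertE singletonD)
qed

lemma theta_neighbors:
  "{w. (0, w) \<in> parcs theta_graph} = {1, 4}" "{w. (1, w) \<in> parcs theta_graph} = {0, 2}"
  "{w. (2, w) \<in> parcs theta_graph} = {1, 3, 5}" "{w. (3, w) \<in> parcs theta_graph} = {2, 4}"
  "{w. (4, w) \<in> parcs theta_graph} = {0, 3, 5}" "{w. (5, w) \<in> parcs theta_graph} = {2, 4}"
  by (auto simp: theta_graph_def theta_edges_def)

lemma dynamic_chromatic_number_theta: "dynamic_chromatic_number 3 theta_graph = 6"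
proof -
  interpret pair_graph theta_graph by (rule pair_graph_theta)
  have verts: "pverts theta_graph = {0, 1, 2, 3, 4, 5}" by (simp add: theta_graph_def)
  have "dynamic_chromatic_number 3 theta_graph = card (pverts theta_graph)"
  proof (rule dynamic_chromatic_number_diameter_two)
    fix v assume "v \<in> pverts theta_graph"
    then have "v \<in> {0, 1, 2, 3, 4, 5}" unfolding verts .
    then show "card {w. (v, w) \<in> parcs theta_graph} \<le> 3"
      by (elim insertE emptyE; simp only: theta_neighbors; simp)
  next
    have "\<forall>u\<in>pverts theta_graph. \<forall>v\<in>pverts theta_graph. u = v \<or>
        (u, v) \<in> parcs theta_graph \<or>
        (\<exists>w\<in>pverts theta_graph. (w, u) \<in> parcs theta_graph \<and> (w, v) \<in> parcs theta_graph)"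
      by (simp add: theta_graph_def theta_edges_def)
    then show "(u, v) \<in> parcs theta_graph \<or>
        (\<exists>w. (w, u) \<in> parcs theta_graph \<and> (w, v) \<in> parcs theta_graph)"
      if "u \<in> pverts theta_graph" "v \<in> pverts theta_graph" "u \<noteq> v" for u v
      using that by blast
  qed
  also have "\<dots> = 6" by (simp add: verts)
  finally show ?thesis .
qed

theorem theorem7:
  shows "\<exists>G :: nat pair_pre_digraph.
    pair_graph G \<and> outer_1_planar G \<and> dynamic_chromatic_number 3 G = 6"
  using pair_graph_theta outer_1_planar_theta dynamic_chromatic_number_theta by blast

end
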